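(* For any set $L$ of nonnegative integers, the language $\mathtt{UPOWER}(L)=\{a^{8^n} \mid n\in L\}$ over the unary alphabet $\{a\}$ can be recognized by a 2qcca with bounded error in $O(|w|\log|w|)$ time, where $w$ is the input.
   Context: A two-way finite automaton with quantum and classical states (2qcfa) has a finite set of classical states (with designated initial, accepting and rejecting states), a quantum register with a finite set of quantum basis states and a designated initial quantum state, and a read-only input tape holding the input between a left and a right end-marker, scanned by a two-way head. In each step a superoperator $\mathcal{E}=\{E_1,\dots,E_k\}$ (finitely many square matrices with $\sum_i E_i^\dagger E_i=I$), determined by the current classical state and scanned symbol, is applied to the quantum register in state $|\psi\rangle$, yielding outcome $i$ with probability $p_i=\|E_i|\psi\rangle\|^2$ and new state $E_i|\psi\rangle/\sqrt{p_i}$; then the next classical state and head move are determined by the classical state, scanned symbol and outcome. Transition amplitudes may be arbitrary real numbers, possibly uncomputable. A 2qcca is a 2qcfa augmented with a classical counter (holding a nonnegative integer, initially 0): the classical transitions may additionally depend on whether the counter is zero and may increment, decrement or leave the counter unchanged. Recognition with bounded error means there is $\epsilon<1/2$ such that members are accepted and non-members rejected, each with probability at least $1-\epsilon$. *)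

theory Defs
  imports
    "HOL-Probability.Probability_Mass_Function"
    "HOL-Library.Landau_Symbols"
    "Jordan_Normal_Form.Schur_Decomposition"
begin

text \<open>
  Vectors and matrices are those of \<^theory>\<open>Jordan_Normal_Form.Matrix\<close>; the quantum basis states of
  a register of dimension \<open>d\<close> are \<open>0, \<dots>, d - 1\<close>.
\<close>

unbundle no vec_syntax

datatype 'a tape_symbol = LeftEnd | Letter 'a | RightEnd

datatype head_move = MoveLeft | Stay | MoveRight

datatype counter_op = Decrement | Keep | Increment

text \<open>
  In \<open>transition M s \<sigma> z i\<close> the Boolean \<open>z\<close> says whether the counter is zero and \<open>i\<close> is the
  outcome of the superoperator \<open>superop M s \<sigma>\<close>, i.e. the (0-based) index of the operation element
  that has been applied. Both functions are only meaningful on non-halting states of the machine.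
\<close>

record ('s, 'a::finite) qcca =
  cstates :: "'s set"
  init :: 's
  acc :: 's
  rej :: 's
  qdim :: nat
  qinit :: nat
  superop :: "'s \<Rightarrow> 'a tape_symbol \<Rightarrow> complex mat list"
  transition :: "'s \<Rightarrow> 'a tape_symbol \<Rightarrow> bool \<Rightarrow> nat \<Rightarrow> 's \<times> head_move \<times> counter_op"

definition superoperator :: "nat \<Rightarrow> complex mat list \<Rightarrow> bool" where
  "superoperator d Es \<longleftrightarrow>
     (\<forall>E\<in>set Es. E \<in> carrier_mat d d) \<and>
     foldr (\<lambda>E S. mat_adjoint E * E + S) Es (0\<^sub>m d d) = 1\<^sub>m d"

definition real_entries :: "complex mat \<Rightarrow> bool" where
  "real_entries E \<longleftrightarrow> (\<forall>i<dim_row E. \<forall>j<dim_col E. E $$ (i, j) \<in> \<real>)"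

definition is_2qcca :: "('s, 'a::finite) qcca \<Rightarrow> bool" where
  "is_2qcca M \<longleftrightarrow>
     finite (cstates M) \<and>
     init M \<in> cstates M \<and> acc M \<in> cstates M \<and> rej M \<in> cstates M \<and> acc M \<noteq> rej M \<and>
     qinit M < qdim M \<and>
     (\<forall>s \<in> cstates M - {acc M, rej M}. \<forall>\<sigma>.
        superoperator (qdim M) (superop M s \<sigma>) \<and>
        (\<forall>E\<in>set (superop M s \<sigma>). real_entries E) \<and>
        (\<forall>z. \<forall>i<length (superop M s \<sigma>).
           case transition M s \<sigma> z i of (s', m, k) \<Rightarrow>
             s' \<in> cstates M \<and>
             (\<sigma> = LeftEnd \<longrightarrow> m \<noteq> MoveLeft) \<and>
             (\<sigma> = RightEnd \<longrightarrow> m \<noteq> MoveRight) \<and>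
             (z \<longrightarrow> k \<noteq> Decrement)))"

definition vec_norm2 :: "complex Matrix.vec \<Rightarrow> real" where
  "vec_norm2 v = (\<Sum>i<dim_vec v. (cmod (v $ i))\<^sup>2)"

text \<open>
  For a superoperator on the space of a unit vector \<open>\<psi>\<close> the numbers below are nonnegative and sum
  up to 1, so that \<^const>\<open>embed_pmf\<close> yields a distribution with exactly these probabilities.
\<close>

definition outcome_pmf :: "complex mat list \<Rightarrow> complex Matrix.vec \<Rightarrow> nat pmf" where
  "outcome_pmf Es \<psi> = embed_pmf (\<lambda>i. if i < length Es then vec_norm2 (Es ! i *\<^sub>v \<psi>) else 0)"

definition post_state :: "complex mat \<Rightarrow> complex Matrix.vec \<Rightarrow> complex Matrix.vec" where
  "post_state E \<psi> = complex_of_real (1 / sqrt (vec_norm2 (E *\<^sub>v \<psi>))) \<cdot>\<^sub>v (E *\<^sub>v \<psi>)"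

record 's config =
  cstate :: 's
  head :: nat
  counter :: nat
  qstate :: "complex Matrix.vec"

definition tape :: "'a list \<Rightarrow> 'a tape_symbol list" where
  "tape w = LeftEnd # map Letter w @ [RightEnd]"

fun move_head :: "head_move \<Rightarrow> nat \<Rightarrow> nat" where
  "move_head MoveLeft p = p - 1"
| "move_head Stay p = p"
| "move_head MoveRight p = p + 1"

fun update_counter :: "counter_op \<Rightarrow> nat \<Rightarrow> nat" where
  "update_counter Decrement n = n - 1"
| "update_counter Keep n = n"
| "update_counter Increment n = n + 1"

definition initial_config :: "('s, 'a::finite) qcca \<Rightarrow> 's config" where
  "initial_config M =
     \<lparr>cstate = init M, head = 0, counter = 0, qstate = unit_vec (qdim M) (qinit M)\<rparr>"

definition halting :: "('s, 'a::finite) qcca \<Rightarrow> 's config \<Rightarrow> bool" where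
  "halting M c \<longleftrightarrow> cstate c = acc M \<or> cstate c = rej M"

definition successor :: "('s, 'a::finite) qcca \<Rightarrow> 'a list \<Rightarrow> 's config \<Rightarrow> nat \<Rightarrow> 's config" where
  "successor M w c i =
     (let \<sigma> = tape w ! head c;
          (s', m, k) = transition M (cstate c) \<sigma> (counter c = 0) i
      in \<lparr>cstate = s', head = move_head m (head c), counter = update_counter k (counter c),
          qstate = post_state (superop M (cstate c) \<sigma> ! i) (qstate c)\<rparr>)"

text \<open>Halting configurations are absorbing.\<close>

definition step :: "('s, 'a::finite) qcca \<Rightarrow> 'a list \<Rightarrow> 's config \<Rightarrow> 's config pmf" where
  "step M w c =
     (if halting M c then return_pmf c
      else map_pmf (successor M w c)
             (outcome_pmf (superop M (cstate c) (tape w ! head c)) (qstate c)))"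

primrec run :: "('s, 'a::finite) qcca \<Rightarrow> 'a list \<Rightarrow> nat \<Rightarrow> 's config pmf" where
  "run M w 0 = return_pmf (initial_config M)"
| "run M w (Suc t) = bind_pmf (run M w t) (step M w)"

text \<open>
  The probability of having halted in a given state after \<open>t\<close> steps is nondecreasing in \<open>t\<close>,
  so the suprema below are the limits for \<open>t\<close> tending to infinity.
\<close>

definition accept_prob :: "('s, 'a::finite) qcca \<Rightarrow> 'a list \<Rightarrow> real" where
  "accept_prob M w = (SUP t. measure_pmf.prob (run M w t) {c. cstate c = acc M})"

definition reject_prob :: "('s, 'a::finite) qcca \<Rightarrow> 'a list \<Rightarrow> real" where
  "reject_prob M w = (SUP t. measure_pmf.prob (run M w t) {c. cstate c = rej M})"

definition recognizes_bounded_error :: "('s, 'a::finite) qcca \<Rightarrow> 'a list set \<Rightarrow> bool" where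
  "recognizes_bounded_error M A \<longleftrightarrow>
     (\<exists>\<epsilon>. 0 \<le> \<epsilon> \<and> \<epsilon> < 1 / 2 \<and>
        (\<forall>w. w \<in> A \<longrightarrow> accept_prob M w \<ge> 1 - \<epsilon>) \<and>
        (\<forall>w. w \<notin> A \<longrightarrow> reject_prob M w \<ge> 1 - \<epsilon>))"

text \<open>Worst-case time: every computation of nonzero probability halts within the bound.\<close>

definition runs_in_time :: "('s, 'a::finite) qcca \<Rightarrow> (nat \<Rightarrow> nat) \<Rightarrow> bool" where
  "runs_in_time M T \<longleftrightarrow> (\<forall>w. \<forall>c \<in> set_pmf (run M w (T (length w))). halting M c)"

datatype unary = Unary_a

instance unary :: finite
proof
  have "(UNIV :: unary set) = {Unary_a}"
    using unary.exhaust by auto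
  then show "finite (UNIV :: unary set)"
    by (metis finite.emptyI finite_insert)
qed

definition UPOWER :: "nat set \<Rightarrow> unary list set" where
  "UPOWER L = {replicate (8 ^ n) Unary_a | n. n \<in> L}"

end

theory Submission
  imports Defs "HOL-Real_Asymp.Real_Asymp"
begin

text \<open>
  Let \<open>\<theta> = \<pi>/2 * (\<Sum>i\<in>L. 8\<^sup>-\<^sup>i)\<close>. Rotating a qubit by \<open>\<theta>\<close> once per input letter turns it, on an
  input of length \<open>8\<^sup>n\<close>, by \<open>\<pi>/2 * ([n \<in> L] + r)\<close> modulo \<open>2\<pi>\<close>, where \<open>0 \<le> r \<le> 1/7\<close> comes from the
  elements of \<open>L\<close> above \<open>n\<close>; a measurement thus decides \<open>n \<in> L\<close> with error below \<open>1/4\<close>.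
  That the length is a power of 8 is checked deterministically by dividing the head position by 8
  as long as possible, with the counter holding the quotient. The head positions decrease
  geometrically, so the total time is in fact linear.
\<close>

section \<open>Outcomes of a superoperator\<close>

lemma vec_norm2_nonneg: "0 \<le> vec_norm2 v"
  by (simp add: vec_norm2_def sum_nonneg)

text \<open>The hypothesis is the normalisation required by \<open>embed_pmf\<close>. It is assumed
  directly because the states that occur are real qubits, for which it is an immediate
  computation.\<close>

lemma pmf_outcome_pmf:
  assumes "(\<Sum>i<length Es. vec_norm2 (Es ! i *\<^sub>v \<psi>)) = 1"
  shows "pmf (outcome_pmf Es \<psi>) i = (if i < length Es then vec_norm2 (Es ! i *\<^sub>v \<psi>) else 0)"
  unfolding outcome_pmf_def
proof (rule pmf_embed_pmf)
  let ?f = "\<lambda>i. if i < length Es then vec_norm2 (Es ! i *\<^sub>v \<psi>) else 0"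
  show nonneg: "\<And>i. 0 \<le> ?f i"
    by (simp add: vec_norm2_nonneg)
  have "(\<integral>\<^sup>+ i. ennreal (?f i) \<partial>count_space UNIV) = (\<Sum>i<length Es. ennreal (?f i))"
    by (rule nn_integral_count_space') auto
  also have "\<dots> = ennreal (\<Sum>i<length Es. ?f i)"
    using nonneg by (intro sum_ennreal)
  also have "\<dots> = 1"
    using assms by simp
  finally show "(\<integral>\<^sup>+ i. ennreal (?f i) \<partial>count_space UNIV) = 1" .
qed

lemma outcome_pmf_single:
  assumes "vec_norm2 (E *\<^sub>v \<psi>) = 1"
  shows "outcome_pmf [E] \<psi> = return_pmf 0"
  using assms by (intro pmf_eqI) (auto simp: pmf_outcome_pmf indicator_def)

lemma post_state_norm1:
  "vec_norm2 (E *\<^sub>v \<psi>) = 1 \<Longrightarrow> post_state E \<psi> = E *\<^sub>v \<psi>"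
  by (simp add: post_state_def)

text \<open>A one-element superoperator has a single outcome, so a point mass stays a point mass.
  This makes everything before the measurement deterministic.\<close>

lemma run_return_Suc:
  assumes "run M w t = return_pmf c" "\<not> halting M c"
    and "superop M (cstate c) (tape w ! head c) = [E]" "vec_norm2 (E *\<^sub>v qstate c) = 1"
  shows "run M w (Suc t) = return_pmf (successor M w c 0)"
  using assms by (simp add: bind_return_pmf step_def outcome_pmf_single)

text \<open>Halting configurations are absorbing. This carries halting at an input-dependent time
  over to the uniform time bound.\<close>

lemma run_add_halting:
  assumes "\<And>c. c \<in> set_pmf (run M w t) \<Longrightarrow> halting M c"
  shows "run M w (t + d) = run M w t"
proof (induction d)
  case (Suc d)
  have "bind_pmf (run M w t) (step M w) = bind_pmf (run M w t) return_pmf"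
    using assms by (intro bind_pmf_cong) (auto simp: step_def)
  then show ?case
    using Suc by (simp add: bind_return_pmf')
qed simp

lemma accept_prob_ge: "measure_pmf.prob (run M w t) {c. cstate c = acc M} \<le> accept_prob M w"
  unfolding accept_prob_def by (rule cSUP_upper) (auto intro!: bdd_aboveI[of _ 1])

lemma reject_prob_ge: "measure_pmf.prob (run M w t) {c. cstate c = rej M} \<le> reject_prob M w"
  unfolding reject_prob_def by (rule cSUP_upper) (auto intro!: bdd_aboveI[of _ 1])

lemma tape_nth:
  "tape w ! 0 = LeftEnd"
  "p < length w \<Longrightarrow> tape w ! Suc p = Letter (w ! p)"
  "tape w ! Suc (length w) = RightEnd"
  by (auto simp: tape_def nth_append)

section \<open>Rotations of a real qubit\<close>

definition rotation :: "real \<Rightarrow> complex mat" where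
  "rotation a = Matrix.mat 2 2
     (\<lambda>(i, j). complex_of_real (if i = j then cos a else if i = 0 then - sin a else sin a))"

text \<open>The real unit vector at angle \<open>x\<close>: rotating adds angles, and the initial
  state has angle 0.\<close>

definition qubit :: "real \<Rightarrow> complex Matrix.vec" where
  "qubit x = Matrix.vec 2 (\<lambda>i. complex_of_real (if i = 0 then cos x else sin x))"

definition projection :: "nat \<Rightarrow> complex mat" where
  "projection k = Matrix.mat 2 2 (\<lambda>(i, j). if i = k \<and> j = k then 1 else 0)"

lemma lessThan_2: "{..<2} = {0, 1::nat}" "{0..<2} = {0, 1::nat}"
  by auto

lemma rotation_mult_qubit: "rotation a *\<^sub>v qubit x = qubit (x + a)"
proof (rule eq_vecI)
  fix i assume "i < dim_vec (qubit (x + a))"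
  then have "i = 0 \<or> i = 1"
    by (auto simp: qubit_def)
  then show "(rotation a *\<^sub>v qubit x) $ i = qubit (x + a) $ i"
    by (auto simp: rotation_def qubit_def scalar_prod_def lessThan_2
        cos_add sin_add simp flip: of_real_mult of_real_add of_real_diff)
qed (simp add: rotation_def qubit_def)

lemma vec_norm2_qubit: "vec_norm2 (qubit x) = 1"
  by (simp add: vec_norm2_def qubit_def lessThan_2)

lemma vec_norm2_projection:
  "vec_norm2 (projection 0 *\<^sub>v qubit x) = (cos x)\<^sup>2"
  "vec_norm2 (projection (Suc 0) *\<^sub>v qubit x) = (sin x)\<^sup>2"
  by (auto simp: vec_norm2_def projection_def qubit_def scalar_prod_def lessThan_2)

lemma mat_adjoint_mult_2:
  assumes "E \<in> carrier_mat 2 2"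
  shows "mat_adjoint E * E =
    Matrix.mat 2 2 (\<lambda>(i, j). cnj (E $$ (0, i)) * E $$ (0, j) + cnj (E $$ (1, i)) * E $$ (1, j))"
  using assms
  by (intro eq_matI) (auto simp: mat_adjoint_def mat_of_rows_def scalar_prod_def lessThan_2)

lemma carrier_mat_rotation: "rotation a \<in> carrier_mat 2 2"
  by (simp add: rotation_def)

lemma carrier_mat_projection: "projection k \<in> carrier_mat 2 2"
  by (simp add: projection_def)

lemma superoperator_rotation: "superoperator 2 [rotation a]"
proof -
  have "mat_adjoint (rotation a) * rotation a = 1\<^sub>m 2"
    unfolding mat_adjoint_mult_2[OF carrier_mat_rotation]
    by (rule eq_matI)
      (auto simp: rotation_def less_2_cases_iff simp flip: of_real_mult of_real_add power2_eq_square)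
  then show ?thesis
    by (simp add: superoperator_def carrier_mat_rotation)
qed

lemma superoperator_projections: "superoperator 2 [projection 0, projection (Suc 0)]"
proof -
  have "mat_adjoint (projection 0) * projection 0 +
      mat_adjoint (projection (Suc 0)) * projection (Suc 0) = 1\<^sub>m 2"
    unfolding mat_adjoint_mult_2[OF carrier_mat_projection]
    by (rule eq_matI) (auto simp: projection_def less_2_cases_iff)
  moreover have "mat_adjoint (projection (Suc 0)) * projection (Suc 0) \<in> carrier_mat 2 2"
    by (simp add: mat_adjoint_mult_2[OF carrier_mat_projection])
  ultimately show ?thesis
    by (simp add: superoperator_def carrier_mat_projection)
qed

lemma real_entries_rotation: "real_entries (rotation a)"
  by (auto simp: real_entries_def rotation_def less_2_cases_iff)

lemma real_entries_projection: "real_entries (projection k)"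
  by (auto simp: real_entries_def projection_def)

section \<open>The rotation angle\<close>

text \<open>The sum is the real number whose base-8 digits, each 0 or 1, are the characteristic
  sequence of \<open>L\<close>; it may be uncomputable.\<close>

definition angle :: "nat set \<Rightarrow> real" where
  "angle L = pi / 2 * (\<Sum>i. of_bool (i \<in> L) / 8 ^ i)"

text \<open>Multiplying by \<open>8 ^ n\<close> shifts the base-8 expansion: digits before position
  \<open>n\<close> become a multiple of 8, digit \<open>n\<close> becomes the unit, and the later
  ones form a fraction \<open>r\<close>, at most 1/8 + 1/64 + ... = 1/7.\<close>

lemma power8_angle:
  obtains N :: nat and r :: real
  where "8 ^ n * angle L = pi / 2 * (8 * real N + of_bool (n \<in> L) + r)" "0 \<le> r" "r \<le> 1 / 7"
proof -
  let ?f = "\<lambda>i. of_bool (i \<in> L) / 8 ^ i :: real"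
  have geo: "(\<lambda>i. (1/8) ^ i :: real) sums (8 / 7)"
    using geometric_sums[of "1/8 :: real"] by simp
  have summ: "summable ?f"
    by (rule summable_comparison_test'[OF sums_summable[OF geo], of 0])
      (auto simp: power_one_over)
  define r where "r = (\<Sum>i. of_bool (i + Suc n \<in> L) / 8 ^ Suc i :: real)"
  have geo': "(\<lambda>i. 1 / 8 ^ Suc i :: real) sums (1 / 7)"
    using sums_mult[OF geo, of "1/8"] by (simp add: power_one_over)
  have summ': "summable (\<lambda>i. of_bool (i + Suc n \<in> L) / 8 ^ Suc i :: real)"
    by (rule summable_comparison_test'[OF sums_summable[OF geo'], of 0]) auto
  have r_bounds: "0 \<le> r" "r \<le> 1 / 7"
  proof -
    show "0 \<le> r"
      unfolding r_def by (intro suminf_nonneg summ') simp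
    show "r \<le> 1 / 7"
      unfolding r_def sums_unique[OF geo']
      by (intro suminf_le summ' sums_summable[OF geo']) (simp add: divide_right_mono)
  qed
  \<comment> \<open>The exponent \<open>n - Suc i\<close> leaves one factor 8 outside
    \<open>N\<close>; that factor turns quarter turns into full turns.\<close>
  define N :: nat where "N = (\<Sum>i<n. of_bool (i \<in> L) * 8 ^ (n - Suc i))"
  have head: "8 ^ n * (\<Sum>i<n. ?f i) = 8 * real N"
  proof -
    have "8 ^ n * ?f i = 8 * (of_bool (i \<in> L) * 8 ^ (n - Suc i))" if "i < n" for i
    proof -
      have "(8::real) ^ n = 8 ^ i * (8 * 8 ^ (n - Suc i))"
        using that power_add[of "8 :: real" i "Suc (n - Suc i)"] by simp
      then show ?thesis
        by simp
    qed
    then show ?thesis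
      unfolding N_def sum_distrib_left of_nat_sum by (intro sum.cong) simp_all
  qed
  have "(\<Sum>i. ?f i) = (\<Sum>i. ?f (i + Suc n)) + (\<Sum>i<Suc n. ?f i)"
    by (rule suminf_split_initial_segment[OF summ])
  moreover have "8 ^ n * (\<Sum>i. ?f (i + Suc n)) = r"
  proof -
    have "8 ^ n * ?f (i + Suc n) = of_bool (i + Suc n \<in> L) / 8 ^ Suc i" for i
      by (simp add: power_add)
    then show ?thesis
      unfolding r_def using suminf_mult[OF summable_ignore_initial_segment[OF summ], of "8 ^ n" "Suc n"]
      by simp
  qed
  ultimately have "8 ^ n * (\<Sum>i. ?f i) = 8 * real N + of_bool (n \<in> L) + r"
    using head by (simp add: distrib_left)
  then have "8 ^ n * angle L = pi / 2 * (8 * real N + of_bool (n \<in> L) + r)"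
    by (simp add: angle_def mult.left_commute)
  then show thesis
    using that r_bounds by blast
qed

lemma sin_small:
  fixes r :: real
  assumes "0 \<le> r" "r \<le> 1 / 7"
  shows "(sin (pi / 2 * r))\<^sup>2 \<le> 1 / 4"
proof -
  \<comment> \<open>The crude bound \<open>pi < 4\<close> gives an angle of at most 2/7, below
    1/2.\<close>
  have "pi / 2 * r \<le> 4 / 2 * (1 / 7)"
    using assms pi_less_4 by (intro mult_mono) auto
  then have "\<bar>sin (pi / 2 * r)\<bar> \<le> 1 / 2"
    using abs_sin_x_le_abs_x[of "pi / 2 * r"] assms by simp
  then have "\<bar>sin (pi / 2 * r)\<bar>\<^sup>2 \<le> (1 / 2)\<^sup>2"
    by (intro power_mono) auto
  then show ?thesis
    by (simp add: power2_eq_square)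
qed

lemma rotation_error:
  shows "n \<in> L \<Longrightarrow> (sin (8 ^ n * angle L))\<^sup>2 \<ge> 3 / 4"
    and "n \<notin> L \<Longrightarrow> (cos (8 ^ n * angle L))\<^sup>2 \<ge> 3 / 4"
proof -
  obtain N :: nat and r :: real
    where eq: "8 ^ n * angle L = pi / 2 * (8 * real N + of_bool (n \<in> L) + r)"
      and r: "0 \<le> r" "r \<le> 1 / 7"
    by (rule power8_angle)
  \<comment> \<open>\<open>8 * N\<close> quarter turns are \<open>2 * N\<close> full turns and drop
    out by periodicity.\<close>
  have *: "8 ^ n * angle L = pi / 2 * of_bool (n \<in> L) + pi / 2 * r + 2 * pi * of_int (2 * int N)"
    unfolding eq by (simp add: algebra_simps)
  have small: "(sin (pi / 2 * r))\<^sup>2 \<le> 1 / 4"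
    using r by (rule sin_small)
  have cs: "(cos (pi / 2 * r))\<^sup>2 \<ge> 3 / 4"
    using small sin_cos_squared_add[of "pi / 2 * r"] by linarith
  have per: "sin (y + 2 * pi * of_int (2 * int N)) = sin y"
    "cos (y + 2 * pi * of_int (2 * int N)) = cos y" for y
    by (simp_all add: sin_add cos_add sin_int_2pin cos_int_2pin del: of_int_mult of_int_of_nat_eq)
  \<comment> \<open>A member adds a quarter turn, which turns sine into cosine; both cases thus rest
    on the same bound \<open>cs\<close>.\<close>
  show "n \<in> L \<Longrightarrow> (sin (8 ^ n * angle L))\<^sup>2 \<ge> 3 / 4"
    using cs unfolding * per by (simp add: sin_add)
  show "n \<notin> L \<Longrightarrow> (cos (8 ^ n * angle L))\<^sup>2 \<ge> 3 / 4"
    using cs unfolding * per by simp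
qed

section \<open>The machine\<close>

text \<open>
  State \<open>j < 8\<close> means that \<open>j\<close> letters modulo 8 have been passed during the current division.
\<close>

abbreviation (input) q_scan :: nat where "q_scan \<equiv> 8"
abbreviation (input) q_up :: nat where "q_up \<equiv> 9"
abbreviation (input) q_acc :: nat where "q_acc \<equiv> 10"
abbreviation (input) q_rej :: nat where "q_rej \<equiv> 11"
abbreviation (input) q_meas :: nat where "q_meas \<equiv> 12"

text \<open>The number \<open>p\<close> under division is the head position. Walking left, every
  eighth letter increments the counter, so the left end-marker is reached in state
  \<open>p mod 8\<close> with counter \<open>p div 8\<close>. There \<open>p = 1\<close> leads to
  the measurement and a positive multiple of 8 to \<open>q_up\<close>, which turns the quotient back
  into a head position.\<close>

definition upower_transition ::
    "nat \<Rightarrow> unary tape_symbol \<Rightarrow> bool \<Rightarrow> nat \<Rightarrow> nat \<times> head_move \<times> counter_op" where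
  "upower_transition s \<sigma> z i =
     (if s = q_meas then (if i = 0 then q_rej else q_acc, Stay, Keep)
      else if s = q_scan then
        (if \<sigma> = RightEnd then (0, MoveLeft, Keep) else (q_scan, MoveRight, Keep))
      else if s = q_up then
        (if z then (0, Stay, Keep)
         else if \<sigma> = RightEnd then (q_rej, Stay, Keep) else (q_up, MoveRight, Decrement))
      else case \<sigma> of
        Letter a \<Rightarrow> if s = 7 then (0, MoveLeft, Increment) else (Suc s, MoveLeft, Keep)
      | LeftEnd \<Rightarrow>
          (if s = 0 \<and> \<not> z then q_up else if s = 1 \<and> z then q_meas else q_rej, Stay, Keep)
      | RightEnd \<Rightarrow> (q_rej, Stay, Keep))"

text \<open>Steps that leave the register alone use the rotation by 0, i.e. the identity. The
  end-markers contribute no angle, so the scan rotates by \<open>length w * angle L\<close> in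
  total.\<close>

definition upower_machine :: "nat set \<Rightarrow> (nat, unary) qcca" where
  "upower_machine L =
     \<lparr>cstates = {..12}, init = q_scan, acc = q_acc, rej = q_rej, qdim = 2, qinit = 0,
      superop = (\<lambda>s \<sigma>. if s = q_meas then [projection 0, projection (Suc 0)]
        else [rotation (if s = q_scan \<and> \<sigma> = Letter Unary_a then angle L else 0)]),
      transition = upower_transition\<rparr>"

lemma is_2qcca_upower_machine: "is_2qcca (upower_machine L)"
  by (auto simp: is_2qcca_def upower_machine_def superoperator_rotation superoperator_projections
      real_entries_rotation real_entries_projection upower_transition_def
      split: tape_symbol.splits if_splits)

section \<open>The deterministic phases of a run\<close>

lemma run_upower_Suc:
  assumes "run (upower_machine L) w t =
      return_pmf \<lparr>cstate = s, head = h, counter = k, qstate = qubit x\<rparr>"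
    and "s \<notin> {q_acc, q_rej, q_meas}"
    and "upower_transition s (tape w ! h) (k = 0) 0 = (s', m, u)"
  shows "run (upower_machine L) w (Suc t) =
      return_pmf \<lparr>cstate = s', head = move_head m h, counter = update_counter u k,
        qstate = qubit (if s = q_scan \<and> tape w ! h = Letter Unary_a then x + angle L else x)\<rparr>"
proof -
  let ?c = "\<lparr>cstate = s, head = h, counter = k, qstate = qubit x\<rparr>"
  let ?E = "rotation (if s = q_scan \<and> tape w ! h = Letter Unary_a then angle L else 0)"
  have E: "superop (upower_machine L) s (tape w ! h) = [?E]"
    using assms(2) by (simp add: upower_machine_def)
  have "run (upower_machine L) w (Suc t) = return_pmf (successor (upower_machine L) w ?c 0)"
    by (rule run_return_Suc[OF assms(1)])
      (use assms(2) E in \<open>auto simp: halting_def upower_machine_def rotation_mult_qubit vec_norm2_qubit\<close>)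
  moreover have "transition (upower_machine L) = upower_transition"
    by (simp add: upower_machine_def)
  ultimately show ?thesis
    using assms(3) E
    by (auto simp: successor_def post_state_norm1 rotation_mult_qubit vec_norm2_qubit)
qed

text \<open>Time \<open>Suc j\<close> counts the step off the left end-marker, which rotates by 0,
  and then \<open>j\<close> letters.\<close>

lemma run_upower_scan:
  "j \<le> length w \<Longrightarrow> run (upower_machine L) w (Suc j) =
     return_pmf \<lparr>cstate = q_scan, head = Suc j, counter = 0, qstate = qubit (j * angle L)\<rparr>"
proof (induction j)
  case 0
  have "unit_vec 2 0 = qubit 0"
    by (rule eq_vecI) (auto simp: qubit_def less_2_cases_iff)
  then have "run (upower_machine L) w 0 =
      return_pmf \<lparr>cstate = q_scan, head = 0, counter = 0, qstate = qubit 0\<rparr>"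
    by (simp add: initial_config_def upower_machine_def)
  from run_upower_Suc[OF this] show ?case
    by (simp add: upower_transition_def tape_nth)
next
  case (Suc j)
  have "w ! j = Unary_a"
    by (cases "w ! j")
  then show ?case
    using Suc.prems run_upower_Suc[OF Suc.IH]
    by (simp add: upower_transition_def tape_nth algebra_simps)
qed

text \<open>The step back from the right end-marker puts the head on position
  \<open>length w\<close>, the first number to be divided.\<close>

lemma run_upower_scan_end:
  "run (upower_machine L) w (length w + 2) =
     return_pmf \<lparr>cstate = 0, head = length w, counter = 0, qstate = qubit (length w * angle L)\<rparr>"
  using run_upower_Suc[OF run_upower_scan[OF order_refl]]
  by (simp add: upower_transition_def tape_nth)

lemma run_upower_down:
  assumes "run (upower_machine L) w t =
      return_pmf \<lparr>cstate = 0, head = p, counter = 0, qstate = qubit x\<rparr>"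
    and "p \<le> length w" "i \<le> p"
  shows "run (upower_machine L) w (t + i) =
      return_pmf \<lparr>cstate = i mod 8, head = p - i, counter = i div 8, qstate = qubit x\<rparr>"
  using assms(3)
proof (induction i)
  case 0
  then show ?case
    using assms(1) by simp
next
  case (Suc i)
  \<comment> \<open>The head is still right of the left end-marker, and
    \<open>p \<le> length w\<close> keeps it off the right one, so it scans a letter.\<close>
  obtain q where q: "p - i = Suc q" "q < length w" "p - Suc i = q"
    using Suc.prems assms(2) by (cases "p - i") auto
  have s: "i mod 8 < 8"
    by simp
  have next_state: "Suc i mod 8 = (if i mod 8 = 7 then 0 else Suc (i mod 8))"
    "Suc i div 8 = (if i mod 8 = 7 then Suc (i div 8) else i div 8)"
    by (auto simp: mod_Suc div_Suc)
  have "run (upower_machine L) w (t + i) =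
      return_pmf \<lparr>cstate = i mod 8, head = Suc q, counter = i div 8, qstate = qubit x\<rparr>"
    using Suc q by simp
  from run_upower_Suc[OF this] show ?case
    using s q by (auto simp: next_state upower_transition_def tape_nth)
qed

lemma run_upower_up:
  assumes "run (upower_machine L) w t =
      return_pmf \<lparr>cstate = q_up, head = 0, counter = k, qstate = qubit x\<rparr>"
    and "k \<le> length w" "j \<le> k"
  shows "run (upower_machine L) w (t + j) =
      return_pmf \<lparr>cstate = q_up, head = j, counter = k - j, qstate = qubit x\<rparr>"
  using assms(3)
proof (induction j)
  case 0
  then show ?case
    using assms(1) by simp
next
  case (Suc j)
  \<comment> \<open>As \<open>j < k \<le> length w\<close>, the head has not yet reached the right
    end-marker, so the rejecting branch of \<open>q_up\<close> is not taken.\<close>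
  have "tape w ! j \<noteq> RightEnd"
    using Suc.prems assms(2) by (cases j) (auto simp: tape_nth)
  with Suc show ?case
    using run_upower_Suc[of L w "t + j"]
    by (auto simp: upower_transition_def)
qed

section \<open>Repeated division by 8\<close>

text \<open>The recursion carried out by the division loop; \<open>p = 1\<close> is its base
  case.\<close>

lemma power_of_8_div:
  fixes p :: nat
  assumes "p \<noteq> 1"
  shows "(\<exists>m. p = 8 ^ m) \<longleftrightarrow> 8 dvd p \<and> (\<exists>m. p div 8 = 8 ^ m)"
proof
  assume "\<exists>m. p = 8 ^ m"
  then obtain m where "p = 8 ^ m" ..
  with assms obtain m' where "p = 8 * 8 ^ m'"
    by (cases m) auto
  then show "8 dvd p \<and> (\<exists>m. p div 8 = 8 ^ m)"
    by auto
next
  assume "8 dvd p \<and> (\<exists>m. p div 8 = 8 ^ m)"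
  then obtain m where "p = 8 * 8 ^ m"
    by (metis dvd_mult_div_cancel)
  then show "\<exists>m. p = 8 ^ m"
    by (metis power_Suc)
qed

text \<open>Strong induction on \<open>p\<close>: one pass replaces \<open>p\<close> by
  \<open>p div 8\<close>, so the pass lengths shrink geometrically and their sum is linear.\<close>

lemma run_upower_division:
  assumes "run (upower_machine L) w t =
      return_pmf \<lparr>cstate = 0, head = p, counter = 0, qstate = qubit x\<rparr>"
    and "p \<le> length w"
  shows "\<exists>d k. d \<le> 4 * p + 4 \<and> run (upower_machine L) w (t + d) =
      return_pmf \<lparr>cstate = if \<exists>m. p = 8 ^ m then q_meas else q_rej, head = 0, counter = k,
        qstate = qubit x\<rparr>"
  using assms
proof (induction p arbitrary: t rule: less_induct)
  case (less p)
  let ?M = "upower_machine L"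
  have down: "run ?M w (t + p) =
      return_pmf \<lparr>cstate = p mod 8, head = 0, counter = p div 8, qstate = qubit x\<rparr>"
    using run_upower_down[OF less.prems order_refl] by simp
  have "p mod 8 < 8"
    by simp
  then have s: "p mod 8 \<noteq> 8" "p mod 8 \<noteq> 9" "p mod 8 \<noteq> 10" "p mod 8 \<noteq> 11" "p mod 8 \<noteq> 12"
    by linarith+
  have turn: "run ?M w (t + p + 1) = return_pmf
      \<lparr>cstate = if p mod 8 = 0 \<and> p div 8 \<noteq> 0 then q_up
         else if p mod 8 = 1 \<and> p div 8 = 0 then q_meas else q_rej,
       head = 0, counter = p div 8, qstate = qubit x\<rparr>"
    using run_upower_Suc[OF down] s by (auto simp: upower_transition_def tape_nth)
  show ?case
  proof (cases "p mod 8 = 0 \<and> p div 8 \<noteq> 0")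
    case True
    then have "p div 8 < p" "8 \<le> p" "8 dvd p"
      by auto
    have "run ?M w (t + p + 1) =
        return_pmf \<lparr>cstate = q_up, head = 0, counter = p div 8, qstate = qubit x\<rparr>"
      using turn True by simp
    then have "run ?M w (t + p + 1 + p div 8) =
        return_pmf \<lparr>cstate = q_up, head = p div 8, counter = 0, qstate = qubit x\<rparr>"
      using run_upower_up[of L w "t + p + 1" "p div 8" x "p div 8"] less.prems \<open>p div 8 < p\<close> by simp
    \<comment> \<open>With the counter at zero, \<open>q_up\<close> becomes state 0 without moving.
      The constant 2 counts this step and the test at the left end-marker.\<close>
    from run_upower_Suc[OF this]
    have "run ?M w (t + p + p div 8 + 2) =
        return_pmf \<lparr>cstate = 0, head = p div 8, counter = 0, qstate = qubit x\<rparr>"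
      by (simp add: upower_transition_def)
    from less.IH[OF \<open>p div 8 < p\<close> this] obtain d k where d: "d \<le> 4 * (p div 8) + 4"
      and run: "run ?M w (t + p + p div 8 + 2 + d) =
        return_pmf \<lparr>cstate = if \<exists>m. p div 8 = 8 ^ m then q_meas else q_rej, head = 0,
          counter = k, qstate = qubit x\<rparr>"
      using less.prems \<open>p div 8 < p\<close> by auto
    have "(\<exists>m. p div 8 = 8 ^ m) \<longleftrightarrow> (\<exists>m. p = 8 ^ m)"
      using power_of_8_div[of p] \<open>8 \<le> p\<close> \<open>8 dvd p\<close> by simp
    with run have "run ?M w (t + (p + p div 8 + 2 + d)) =
        return_pmf \<lparr>cstate = if \<exists>m. p = 8 ^ m then q_meas else q_rej, head = 0,
          counter = k, qstate = qubit x\<rparr>"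
      by (simp add: add.assoc)
    moreover have "p + p div 8 + 2 + d \<le> 4 * p + 4"
      \<comment> \<open>The total is at most \<open>p + 5 * (p div 8) + 6\<close>, and
        \<open>8 \<le> p\<close> absorbs the constant.\<close>
      using d \<open>8 \<le> p\<close> by linarith
    ultimately show ?thesis
      by blast
  next
    case False
    \<comment> \<open>Here \<open>p\<close> is 0 or not a multiple of 8, so the only power of 8 it
      can be is 1.\<close>
    have "(\<exists>m. p = 8 ^ m) \<longleftrightarrow> p = 1"
    proof (cases "p = 1")
      case True
      then show ?thesis
        by (auto intro: exI[of _ 0])
    next
      case neq: False
      then show ?thesis
        using power_of_8_div[OF neq] False by (auto simp: dvd_eq_mod_eq_0)
    qed
    moreover have "p = 1 \<longleftrightarrow> p mod 8 = 1 \<and> p div 8 = 0"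
      by auto
    ultimately have "run ?M w (t + (p + 1)) =
        return_pmf \<lparr>cstate = if \<exists>m. p = 8 ^ m then q_meas else q_rej, head = 0,
          counter = p div 8, qstate = qubit x\<rparr>"
      using turn False by (simp add: add.assoc)
    moreover have "p + 1 \<le> 4 * p + 4"
      by simp
    ultimately show ?thesis
      by blast
  qed
qed

section \<open>The final measurement\<close>

lemma run_upower_measure:
  assumes "run (upower_machine L) w t =
      return_pmf \<lparr>cstate = q_meas, head = h, counter = k, qstate = qubit x\<rparr>"
  shows "measure_pmf.prob (run (upower_machine L) w (Suc t)) {c. cstate c = q_acc} = (sin x)\<^sup>2"
    and "measure_pmf.prob (run (upower_machine L) w (Suc t)) {c. cstate c = q_rej} = (cos x)\<^sup>2"
    and "\<And>c. c \<in> set_pmf (run (upower_machine L) w (Suc t)) \<Longrightarrow> halting (upower_machine L) c"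
proof -
  let ?Es = "[projection 0, projection (Suc 0)]"
  let ?c = "\<lparr>cstate = q_meas, head = h, counter = k, qstate = qubit x\<rparr>"
  have pmf: "pmf (outcome_pmf ?Es (qubit x)) i = (if i < length ?Es
      then vec_norm2 (?Es ! i *\<^sub>v qubit x) else 0)" for i
    by (rule pmf_outcome_pmf) (simp add: vec_norm2_projection)
  have run: "run (upower_machine L) w (Suc t) =
      map_pmf (successor (upower_machine L) w ?c) (outcome_pmf ?Es (qubit x))"
    using assms by (simp add: bind_return_pmf step_def halting_def upower_machine_def)
  have succ: "cstate (successor (upower_machine L) w ?c i) = (if i = 0 then q_rej else q_acc)" for i
    by (simp add: successor_def upower_machine_def upower_transition_def)
  have rej_eq: "measure_pmf.prob (outcome_pmf ?Es (qubit x)) {0} = (cos x)\<^sup>2"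
    by (simp add: measure_pmf_single pmf vec_norm2_projection)
  \<comment> \<open>Every outcome other than 0 accepts, so acceptance is the complement of rejection
    and has probability \<open>1 - (cos x)^2\<close>.\<close>
  have "{i. 0 < i} = UNIV - {0::nat}"
    by auto
  then have acc_eq: "measure_pmf.prob (outcome_pmf ?Es (qubit x)) {i. 0 < i} = (sin x)\<^sup>2"
    using measure_pmf.prob_compl[of "{0}" "outcome_pmf ?Es (qubit x)"] rej_eq
    by (simp add: sin_squared_eq)
  show "measure_pmf.prob (run (upower_machine L) w (Suc t)) {c. cstate c = q_acc} = (sin x)\<^sup>2"
    "measure_pmf.prob (run (upower_machine L) w (Suc t)) {c. cstate c = q_rej} = (cos x)\<^sup>2"
    unfolding run by (simp_all add: vimage_def succ acc_eq rej_eq)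
  show "\<And>c. c \<in> set_pmf (run (upower_machine L) w (Suc t)) \<Longrightarrow> halting (upower_machine L) c"
    unfolding run by (auto simp: halting_def succ) (auto simp: upower_machine_def)
qed

text \<open>The bound adds \<open>length w + 2\<close> steps of scanning, at most
  \<open>4 * length w + 4\<close> of dividing and one of measuring. Without a power of 8 the
  rejection is certain.\<close>

lemma run_upower_cases:
  obtains (power) m t where "length w = 8 ^ m" "t \<le> 5 * length w + 7"
      "measure_pmf.prob (run (upower_machine L) w t) {c. cstate c = q_acc} = (sin (8 ^ m * angle L))\<^sup>2"
      "measure_pmf.prob (run (upower_machine L) w t) {c. cstate c = q_rej} = (cos (8 ^ m * angle L))\<^sup>2"
      "\<And>c. c \<in> set_pmf (run (upower_machine L) w t) \<Longrightarrow> halting (upower_machine L) c"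
  | (no_power) t c where "\<And>m. length w \<noteq> 8 ^ m" "t \<le> 5 * length w + 7"
      "run (upower_machine L) w t = return_pmf c" "cstate c = q_rej"
proof -
  from run_upower_division[OF run_upower_scan_end order_refl] obtain d k
    where d: "d \<le> 4 * length w + 4"
      and run: "run (upower_machine L) w (length w + 2 + d) =
        return_pmf \<lparr>cstate = if \<exists>m. length w = 8 ^ m then q_meas else q_rej, head = 0,
          counter = k, qstate = qubit (length w * angle L)\<rparr>"
    by blast
  show thesis
  proof (cases "\<exists>m. length w = 8 ^ m")
    case True
    then obtain m where m: "length w = 8 ^ m" ..
    with run have "run (upower_machine L) w (length w + 2 + d) =
        return_pmf \<lparr>cstate = q_meas, head = 0, counter = k, qstate = qubit (8 ^ m * angle L)\<rparr>"
      by auto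
    from run_upower_measure[OF this] m d show thesis
      by (intro power[of m "Suc (length w + 2 + d)"]) auto
  next
    case False
    with run d show thesis
      by (intro no_power[of "length w + 2 + d"]) auto
  qed
qed

section \<open>Recognition and running time\<close>

lemma UPOWER_iff: "w \<in> UPOWER L \<longleftrightarrow> (\<exists>n\<in>L. length w = 8 ^ n)"
proof -
  have "w = replicate (length w) Unary_a"
    by (rule replicate_length_same[symmetric]) (metis unary.exhaust)
  then show ?thesis
    unfolding UPOWER_def by (auto simp: set_eq_iff)
qed

lemma recognizes_upower_machine:
  "recognizes_bounded_error (upower_machine L) (UPOWER L)"
  unfolding recognizes_bounded_error_def
\<comment> \<open>The error 1/4 is the one of \<open>rotation_error\<close>; rejecting a wrong
  length is free of error.\<close>
proof (intro exI[of _ "1/4"] conjI allI impI)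
  let ?M = "upower_machine L"
  have states: "acc ?M = q_acc" "rej ?M = q_rej"
    by (simp_all add: upower_machine_def)
  fix w :: "unary list"
  show "1 - 1/4 \<le> accept_prob ?M w" if "w \<in> UPOWER L"
  proof (cases rule: run_upower_cases[of w L])
    case (power m t)
    \<comment> \<open>The length determines the exponent, since powers of 8 are distinct.\<close>
    with that have "m \<in> L"
      by (auto simp: UPOWER_iff)
    then show ?thesis
      using rotation_error(1)[of m L] power accept_prob_ge[of ?M w t] by (simp add: states)
  qed (use that in \<open>auto simp: UPOWER_iff\<close>)
  show "1 - 1/4 \<le> reject_prob ?M w" if "w \<notin> UPOWER L"
  proof (cases rule: run_upower_cases[of w L])
    case (power m t)
    with that have "m \<notin> L"
      by (auto simp: UPOWER_iff)
    then show ?thesis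
      using rotation_error(2)[of m L] power reject_prob_ge[of ?M w t] by (simp add: states)
  next
    case (no_power t c)
    then show ?thesis
      using reject_prob_ge[of ?M w t] by (simp add: states)
  qed
qed auto

lemma runs_in_time_upower_machine: "runs_in_time (upower_machine L) (\<lambda>n. 5 * n + 7)"
  unfolding runs_in_time_def
proof (intro allI ballI)
  let ?M = "upower_machine L"
  fix w :: "unary list" and c
  assume c: "c \<in> set_pmf (run ?M w (5 * length w + 7))"
  obtain t where t: "t \<le> 5 * length w + 7"
    and halt: "\<And>c. c \<in> set_pmf (run ?M w t) \<Longrightarrow> halting ?M c"
  proof (cases rule: run_upower_cases[of w L])
    case (no_power t c)
    then show ?thesis
      using that[of t] by (simp add: halting_def upower_machine_def)
  qed blast
  have "run ?M w (5 * length w + 7) = run ?M w t"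
    using run_add_halting[where M = ?M and w = w and t = t and d = "5 * length w + 7 - t", OF halt] t by simp
  with c halt show "halting ?M c"
    by simp
qed

theorem theorem5:
  fixes L :: "nat set"
  shows "\<exists>(M :: (nat, unary) qcca) T.
           is_2qcca M \<and>
           recognizes_bounded_error M (UPOWER L) \<and>
           runs_in_time M T \<and>
           (\<lambda>n. real (T n)) \<in> O(\<lambda>n. real n * ln (real n))"
proof (intro exI conjI)
  \<comment> \<open>A linear bound is stronger than required. The comparison is asymptotic, so the
    zeros of \<open>n * ln n\<close> at 0 and 1 do no harm.\<close>
  show "(\<lambda>n. real (5 * n + 7)) \<in> O(\<lambda>n. real n * ln (real n))"
    by real_asymp
qed (rule is_2qcca_upower_machine recognizes_upower_machine runs_in_time_upower_machine)+

end
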